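(* Let $x$ be a real number and $\kappa$ a positive integer. Then the $\mathcal{R}(p,q)$-deformed binomial coefficients satisfy the recursion relation $$\begin{bmatrix} x\\ \kappa\end{bmatrix} = \epsilon_1^{\kappa}\begin{bmatrix} x-1\\ \kappa\end{bmatrix}+\epsilon_2^{x-\kappa}\begin{bmatrix} x-1\\ \kappa-1\end{bmatrix}$$ and, equivalently, the recursion relation $$\begin{bmatrix} x\\ \kappa\end{bmatrix} = \epsilon_2^{\kappa}\begin{bmatrix} x-1\\ \kappa\end{bmatrix}+\epsilon_1^{x-\kappa}\begin{bmatrix} x-1\\ \kappa-1\end{bmatrix},$$ with the initial condition $\begin{bmatrix} x\\ 0\end{bmatrix}=1$.
   Context: Let $0<q<p\le 1$ be real numbers and let $\mathcal{R}$ be a meromorphic function of two variables. For real $u$ the $\mathcal{R}(p,q)$-deformed number is $[u]:=\mathcal{R}(p^u,q^u)$. Standing assumption: there are positive real numbers $\epsilon_1=\Phi_1(p,q)$, $\epsilon_2=\Phi_2(p,q)$ such that for all real $u,v$, $$[u+v]=\epsilon_1^{v}[u]+\epsilon_2^{u}[v],$$ and $[k]\neq0$ for every integer $k\ge1$. Define, for real $u$ and integer $\kappa\ge1$, the deformed factorial of $u$ of order $\kappa$ by $[u]_{\kappa}:=\prod_{v=1}^{\kappa}[u-v+1]$, with $[u]_0:=1$; the factorial $[k]!:=[1][2]\cdots[k]$, $[0]!:=1$; and the deformed binomial coefficient $\begin{bmatrix}u\\ \kappa\end{bmatrix}:=[u]_\kappa/[\kappa]!$ (all with respect to $\mathcal{R}(p,q)$).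 *)

theory Defs
  imports "HOL-Analysis.Analysis"
begin

text \<open>Complex Frechet differentiability in two variables: the real-linear derivative at
  each point is required to be complex-linear.\<close>

definition holomorphic2_on :: "(complex \<times> complex \<Rightarrow> complex) \<Rightarrow> (complex \<times> complex) set \<Rightarrow> bool"
  where "holomorphic2_on f U \<longleftrightarrow>
    (\<forall>z\<in>U. \<exists>a b. (f has_derivative (\<lambda>(h, k). a * h + b * k)) (at z within U))"

text \<open>Locally a quotient of holomorphic functions whose denominator does not vanish identically.
  Meromorphic functions are modelled by total functions; as for the library's one-variable
  \<open>meromorphic_on\<close>, the values where the local quotient is not defined are not prescribed.\<close>

definition meromorphic2_on :: "(complex \<times> complex \<Rightarrow> complex) \<Rightarrow> (complex \<times> complex) set \<Rightarrow> bool"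
  where "meromorphic2_on f D \<longleftrightarrow>
    (\<forall>z\<in>D. \<exists>U g h. open U \<and> connected U \<and> z \<in> U \<and> holomorphic2_on g U \<and> holomorphic2_on h U \<and>
       (\<exists>w\<in>U. h w \<noteq> 0) \<and> (\<forall>w\<in>U. h w \<noteq> 0 \<longrightarrow> f w = g w / h w))"

definition deformed_number :: "(complex \<times> complex \<Rightarrow> complex) \<Rightarrow> real \<Rightarrow> real \<Rightarrow> real \<Rightarrow> complex"
  where "deformed_number R p q u = R (of_real (p powr u), of_real (q powr u))"

definition deformed_falling_fact ::
    "(complex \<times> complex \<Rightarrow> complex) \<Rightarrow> real \<Rightarrow> real \<Rightarrow> real \<Rightarrow> nat \<Rightarrow> complex"
  where "deformed_falling_fact R p q u k = (\<Prod>v = 1..k. deformed_number R p q (u - real v + 1))"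

definition deformed_fact :: "(complex \<times> complex \<Rightarrow> complex) \<Rightarrow> real \<Rightarrow> real \<Rightarrow> nat \<Rightarrow> complex"
  where "deformed_fact R p q k = (\<Prod>j = 1..k. deformed_number R p q (real j))"

definition deformed_binomial ::
    "(complex \<times> complex \<Rightarrow> complex) \<Rightarrow> real \<Rightarrow> real \<Rightarrow> real \<Rightarrow> nat \<Rightarrow> complex"
  where "deformed_binomial R p q u k = deformed_falling_fact R p q u k / deformed_fact R p q k"

end

theory Submission
  imports Defs
begin

text \<open>Expanding \<open>[x]\<close> by the addition formula at \<open>x = (x - \<kappa>) + \<kappa>\<close> and at
  \<open>x = \<kappa> + (x - \<kappa>)\<close> writes it in two ways as a combination of \<open>[x - \<kappa>]\<close> and \<open>[\<kappa>]\<close>.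
  Multiplying by \<open>[x - 1]\<^sub>\<kappa>\<^sub>-\<^sub>1 / [\<kappa>]!\<close>, the factor \<open>[x - \<kappa>]\<close> completes the falling factorial
  to \<open>[x - 1]\<^sub>\<kappa>\<close>, while \<open>[\<kappa>]\<close> cancels against \<open>[\<kappa>]!\<close>.\<close>

lemma deformed_falling_fact_0 [simp]: "deformed_falling_fact R p q u 0 = 1"
  by (simp add: deformed_falling_fact_def)

lemma deformed_fact_0 [simp]: "deformed_fact R p q 0 = 1"
  by (simp add: deformed_fact_def)

lemma deformed_binomial_0 [simp]: "deformed_binomial R p q u 0 = 1"
  by (simp add: deformed_binomial_def)

lemma deformed_fact_Suc:
  "deformed_fact R p q (Suc k) = deformed_fact R p q k * deformed_number R p q (real (Suc k))"
  by (simp add: deformed_fact_def)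

lemma deformed_falling_fact_Suc:
  "deformed_falling_fact R p q u (Suc k) =
     deformed_falling_fact R p q u k * deformed_number R p q (u - real k)"
  by (simp add: deformed_falling_fact_def)

text \<open>The defining product grows at its last factor; the recursion needs the first factor
  \<open>[u]\<close> split off instead, since the addition formula is applied to it. Induction
  transfers the last factor from one side to the other.\<close>

lemma deformed_falling_fact_Suc_shift:
  "deformed_falling_fact R p q u (Suc k) =
     deformed_number R p q u * deformed_falling_fact R p q (u - 1) k"
proof (induction k)
  case 0
  show ?case by (simp add: deformed_falling_fact_def)
next
  case (Suc k)
  have "deformed_falling_fact R p q u (Suc (Suc k)) =
      deformed_number R p q u * deformed_falling_fact R p q (u - 1) k *
      deformed_number R p q (u - real (Suc k))"
    by (subst deformed_falling_fact_Suc) (simp only: Suc.IH)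
  \<comment> \<open>The last factor for \<open>u\<close> at order k + 2 is the last factor for
    \<open>u - 1\<close> at order k + 1.\<close>
  also have "u - real (Suc k) = u - 1 - real k"
    by simp
  finally show ?case
    by (simp only: deformed_falling_fact_Suc mult.assoc)
qed

text \<open>The coefficients \<open>a\<close> and \<open>b\<close> stay arbitrary so that both
  recursions become instances, one for each way of expanding \<open>[u]\<close>.\<close>

lemma deformed_binomial_Suc_split:
  assumes "deformed_number R p q u =
      a * deformed_number R p q (u - real (Suc k)) + b * deformed_number R p q (real (Suc k))"
    and "deformed_number R p q (real (Suc k)) \<noteq> 0"
  shows "deformed_binomial R p q u (Suc k) =
      a * deformed_binomial R p q (u - 1) (Suc k) + b * deformed_binomial R p q (u - 1) k"
proof -
  define F where "F = deformed_falling_fact R p q (u - 1) k"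
  define G where "G = deformed_fact R p q k"
  define M where "M = deformed_number R p q (u - real (Suc k))"
  define N where "N = deformed_number R p q (real (Suc k))"
  have shift: "u - 1 - real k = u - real (Suc k)"
    by simp
  have "deformed_binomial R p q u (Suc k) = (a * M + b * N) * F / (G * N)"
    unfolding deformed_binomial_def deformed_falling_fact_Suc_shift deformed_fact_Suc assms(1)
      F_def G_def M_def N_def ..
  \<comment> \<open>Only \<open>N\<close> is cancelled, so \<open>N\<close> \<noteq> 0 suffices:
    with division by zero equal to zero, the identity holds whatever the value of
    \<open>G\<close>.\<close>
  also have "\<dots> = a * (F * M / (G * N)) + b * (F / G)"
    using assms(2) unfolding N_def [symmetric]
    by (simp add: distrib_left distrib_right add_divide_distrib ac_simps)
  also have "F * M / (G * N) = deformed_binomial R p q (u - 1) (Suc k)"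
    unfolding deformed_binomial_def deformed_falling_fact_Suc deformed_fact_Suc shift
      F_def G_def M_def N_def ..
  also have "F / G = deformed_binomial R p q (u - 1) k"
    unfolding deformed_binomial_def F_def G_def ..
  finally show ?thesis .
qed

theorem theorem3p6:
  fixes p q \<epsilon>1 \<epsilon>2 x :: real
    and \<Phi>1 \<Phi>2 :: "real \<Rightarrow> real \<Rightarrow> real"
    and R :: "complex \<times> complex \<Rightarrow> complex"
    and \<kappa> :: nat
  assumes "0 < q" "q < p" "p \<le> 1"
    and "meromorphic2_on R UNIV"
    and "\<epsilon>1 = \<Phi>1 p q" "\<epsilon>2 = \<Phi>2 p q"
    and "\<epsilon>1 > 0" "\<epsilon>2 > 0"
    and "\<And>u v :: real. deformed_number R p q (u + v) =
           of_real (\<epsilon>1 powr v) * deformed_number R p q u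
         + of_real (\<epsilon>2 powr u) * deformed_number R p q v"
    and "\<And>k :: nat. k \<ge> 1 \<Longrightarrow> deformed_number R p q (real k) \<noteq> 0"
    and "\<kappa> \<ge> 1"
  shows "deformed_binomial R p q x \<kappa> =
             of_real (\<epsilon>1 ^ \<kappa>) * deformed_binomial R p q (x - 1) \<kappa>
           + of_real (\<epsilon>2 powr (x - real \<kappa>)) * deformed_binomial R p q (x - 1) (\<kappa> - 1)
       \<and> deformed_binomial R p q x \<kappa> =
             of_real (\<epsilon>2 ^ \<kappa>) * deformed_binomial R p q (x - 1) \<kappa>
           + of_real (\<epsilon>1 powr (x - real \<kappa>)) * deformed_binomial R p q (x - 1) (\<kappa> - 1)
       \<and> deformed_binomial R p q x 0 = 1"
proof -
  obtain k where \<kappa>: "\<kappa> = Suc k"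
    using \<open>\<kappa> \<ge> 1\<close> by (cases \<kappa>) auto
  let ?N = "deformed_number R p q"
  have N\<kappa>: "?N (real (Suc k)) \<noteq> 0"
    using assms(10) [of "Suc k"] by simp
  \<comment> \<open>The addition formula yields a \<open>powr\<close> with exponent
    \<open>real (Suc k)\<close>; positivity of the base turns it into the natural power.\<close>
  have "?N x = of_real (\<epsilon>1 ^ Suc k) * ?N (x - real (Suc k))
      + of_real (\<epsilon>2 powr (x - real (Suc k))) * ?N (real (Suc k))"
    using assms(9) [of "x - real (Suc k)" "real (Suc k)"] powr_realpow [OF \<open>\<epsilon>1 > 0\<close>, of "Suc k"]
    by (simp only: diff_add_cancel)
  note first = deformed_binomial_Suc_split [OF this N\<kappa>]
  \<comment> \<open>The right side of the addition formula is not visibly symmetric in u and v, so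
    swapping the summands exchanges the roles of \<epsilon>1 and \<epsilon>2.\<close>
  have "?N x = of_real (\<epsilon>2 ^ Suc k) * ?N (x - real (Suc k))
      + of_real (\<epsilon>1 powr (x - real (Suc k))) * ?N (real (Suc k))"
    using assms(9) [of "real (Suc k)" "x - real (Suc k)"] powr_realpow [OF \<open>\<epsilon>2 > 0\<close>, of "Suc k"]
    by (simp only: add_diff_cancel_right' add_diff_eq add.commute)
  note second = deformed_binomial_Suc_split [OF this N\<kappa>]
  show ?thesis
    using first second by (simp only: \<kappa> diff_Suc_1 deformed_binomial_0)
qed

end
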